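(* Let $\mathcal I$ and $\mathcal J$ be ideals on $\mathbb N$ with $\mathcal I\subsetneq\mathcal J$ and let $k$ be a positive integer. Then $\dim(c_{0,\mathcal J}/c_{0,\mathcal I})=k$ if and only if $\mathcal I$ is $k$-maximal in $\mathcal J$.
   Context: An ideal on $\mathbb N$ is a family of subsets of $\mathbb N$ containing $\emptyset$ and closed under subsets and finite unions; every ideal is assumed to contain all finite sets (it may equal $\mathcal P(\mathbb N)$). A maximal ideal is a proper ideal whose only proper extension is $\mathcal P(\mathbb N)$. $\ell_\infty$ is the real Banach lattice of bounded real sequences, and $c_{0,\mathcal I}$ is the closed subspace of all $(x_n)\in\ell_\infty$ with $\{n:|x_n|\ge\varepsilon\}\in\mathcal I$ for every $\varepsilon>0$ (so $c_{0,\mathcal P(\mathbb N)}=\ell_\infty$). For ideals $\mathcal I\subsetneq\mathcal J$ on $\mathbb N$ and a positive integer $k$, $\mathcal I$ is $k$-maximal in $\mathcal J$ if there is a family $\{\mathcal L_1,\dots,\mathcal L_k\}$ of pairwise distinct maximal ideals on $\mathbb N$ with $\mathcal J\not\subseteq\mathcal L_i$ for all $1\le i\le k$ and $\mathcal I=\left(\bigcap_{i=1}^k\mathcal L_i\right)\cap\mathcal J$. *)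

theory Defs
  imports "HOL-Analysis.Bounded_Continuous_Function" "HOL-Algebra.AbelCoset"
    "Jordan_Normal_Form.VS_Connect"
begin

definition ideal_on_nat :: "nat set set \<Rightarrow> bool" where
  "ideal_on_nat I \<longleftrightarrow>
     {} \<in> I \<and>
     (\<forall>A\<in>I. \<forall>B. B \<subseteq> A \<longrightarrow> B \<in> I) \<and>
     (\<forall>A\<in>I. \<forall>B\<in>I. A \<union> B \<in> I) \<and>
     (\<forall>A. finite A \<longrightarrow> A \<in> I)"

definition maximal_ideal_on_nat :: "nat set set \<Rightarrow> bool" where
  "maximal_ideal_on_nat L \<longleftrightarrow>
     ideal_on_nat L \<and> L \<noteq> UNIV \<and>
     (\<forall>K. ideal_on_nat K \<and> L \<subset> K \<longrightarrow> K = UNIV)"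

text \<open>Meaningful only for ideals \<open>I \<subset> J\<close> and \<open>k > 0\<close>; these
  standing assumptions are not part of the definition.\<close>

definition k_maximal_in :: "nat \<Rightarrow> nat set set \<Rightarrow> nat set set \<Rightarrow> bool" where
  "k_maximal_in k I J \<longleftrightarrow>
     (\<exists>L :: nat \<Rightarrow> nat set set.
        inj_on L {1..k} \<and>
        (\<forall>i\<in>{1..k}. maximal_ideal_on_nat (L i) \<and> \<not> J \<subseteq> L i) \<and>
        I = (\<Inter>i\<in>{1..k}. L i) \<inter> J)"

text \<open>The topology of \<^typ>\<open>nat\<close> is discrete, so \<^typ>\<open>nat \<Rightarrow>\<^sub>C real\<close> is the
  space of all bounded real sequences with the supremum norm.\<close>

definition c0_ideal :: "nat set set \<Rightarrow> (nat \<Rightarrow>\<^sub>C real) set" where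
  "c0_ideal I = {x. \<forall>\<epsilon>>0. {n. \<bar>apply_bcontfun x n\<bar> \<ge> \<epsilon>} \<in> I}"

text \<open>A linear subspace \<open>S\<close> of a real vector space as a record for the carrier-based
  linear algebra of \<^locale>\<open>vectorspace\<close>; the ring multiplication and unit of such a record
  play no role.\<close>

definition real_vs :: "'a::real_vector set \<Rightarrow> (real, 'a) module" where
  "real_vs S = \<lparr>carrier = S, mult = undefined, one = undefined, zero = 0, add = (+),
     smult = (*\<^sub>R)\<rparr>"

text \<open>The union over representatives avoids a choice: all the cosets in it coincide.
  Scaling \<open>X\<close> pointwise would give \<open>{0}\<close> instead of \<open>N\<close> for the scalar \<open>0\<close>.\<close>

definition quotient_module :: "('a, 'b) module \<Rightarrow> 'b set \<Rightarrow> ('a, 'b set) module" where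
  "quotient_module M N = \<lparr>carrier = a_rcosets\<^bsub>M\<^esub> N, mult = undefined, one = undefined,
     zero = N, add = (\<lambda>X Y. X <+>\<^bsub>M\<^esub> Y),
     smult = (\<lambda>c X. \<Union>x\<in>X. N +>\<^bsub>M\<^esub> (c \<odot>\<^bsub>M\<^esub> x))\<rparr>"

text \<open>\<open>vectorspace.dim\<close> is a least element that is unspecified in the absence of a finite
  generating set, so finite-dimensionality has to be required as well.\<close>

definition has_dim :: "(real, 'v) module \<Rightarrow> nat \<Rightarrow> bool" where
  "has_dim V k \<longleftrightarrow> vectorspace.fin_dim class_ring V \<and> vectorspace.dim class_ring V = k"

lemma subspace_c0_ideal:
  assumes "ideal_on_nat I"
  shows "Real_Vector_Spaces.subspace (c0_ideal I)"
proof -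
  have sub: "B \<in> I" if "A \<in> I" "B \<subseteq> A" for A B
    using assms that by (auto simp: ideal_on_nat_def)
  have un: "A \<union> B \<in> I" if "A \<in> I" "B \<in> I" for A B
    using assms that by (auto simp: ideal_on_nat_def)
  have emp: "{} \<in> I" using assms by (auto simp: ideal_on_nat_def)
  show ?thesis
  proof (rule Real_Vector_Spaces.subspaceI)
    have "{n. \<bar>apply_bcontfun (0 :: nat \<Rightarrow>\<^sub>C real) n\<bar> \<ge> e} \<in> I" if "e > 0" for e
      using that emp by simp
    then show "0 \<in> c0_ideal I" by (simp add: c0_ideal_def)
  next
    fix x y assume x: "x \<in> c0_ideal I" and y: "y \<in> c0_ideal I"
    have "{n. \<bar>apply_bcontfun (x + y) n\<bar> \<ge> e} \<in> I" if "e > 0" for e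
    proof (rule sub)
      have "e / 2 > 0" using that by simp
      with x y show "{n. \<bar>apply_bcontfun x n\<bar> \<ge> e/2} \<union> {n. \<bar>apply_bcontfun y n\<bar> \<ge> e/2} \<in> I"
        unfolding c0_ideal_def mem_Collect_eq by (intro un) metis+
      show "{n. \<bar>apply_bcontfun (x + y) n\<bar> \<ge> e}
              \<subseteq> {n. \<bar>apply_bcontfun x n\<bar> \<ge> e/2} \<union> {n. \<bar>apply_bcontfun y n\<bar> \<ge> e/2}"
        by (auto simp: plus_bcontfun.rep_eq)
    qed
    then show "x + y \<in> c0_ideal I" by (simp add: c0_ideal_def)
  next
    fix c x assume x: "x \<in> c0_ideal I"
    have "{n. \<bar>apply_bcontfun (c *\<^sub>R x) n\<bar> \<ge> e} \<in> I" if e: "e > 0" for e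
    proof (cases "c = 0")
      case True
      then show ?thesis using e emp by (simp add: scaleR_bcontfun.rep_eq)
    next
      case False
      then have "{n. \<bar>apply_bcontfun (c *\<^sub>R x) n\<bar> \<ge> e} = {n. \<bar>apply_bcontfun x n\<bar> \<ge> e / \<bar>c\<bar>}"
        by (auto simp: scaleR_bcontfun.rep_eq abs_mult field_simps)
      moreover have "e / \<bar>c\<bar> > 0" using e False by simp
      ultimately show ?thesis using x by (auto simp: c0_ideal_def)
    qed
    then show "c *\<^sub>R x \<in> c0_ideal I" by (simp add: c0_ideal_def)
  qed
qed

lemma vectorspace_real_vs:
  assumes "Real_Vector_Spaces.subspace S"
  shows "vectorspace class_ring (real_vs S)"
proof -
  have ab: "abelian_group (real_vs S)"
  proof (rule abelian_groupI)
    fix x assume "x \<in> carrier (real_vs S)"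
    then show "\<exists>y\<in>carrier (real_vs S). y \<oplus>\<^bsub>real_vs S\<^esub> x = \<zero>\<^bsub>real_vs S\<^esub>"
      using Real_Vector_Spaces.subspace_neg[OF assms]
      by (auto simp: real_vs_def intro!: bexI[of _ "- x"])
  qed (use assms in \<open>auto simp: real_vs_def Real_Vector_Spaces.subspace_def\<close>)
  have "Module.module class_ring (real_vs S)"
    by (rule moduleI[OF class_cring.is_cring ab])
      (use assms in \<open>auto simp: real_vs_def Real_Vector_Spaces.subspace_def algebra_simps\<close>)
  then show ?thesis
    by (simp add: vectorspace_def class_field)
qed

lemma submodule_real_vs:
  assumes "Real_Vector_Spaces.subspace S" "Real_Vector_Spaces.subspace N" "N \<subseteq> S"
  shows "Module.submodule N class_ring (real_vs S)"
proof -
  interpret vectorspace class_ring "real_vs S" by (rule vectorspace_real_vs) fact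
  have inv: "\<ominus>\<^bsub>real_vs S\<^esub> x = - x" if "x \<in> N" for x
  proof (rule minus_equality)
    show "x \<in> carrier (real_vs S)" "- x \<in> carrier (real_vs S)"
      using that assms Real_Vector_Spaces.subspace_neg[of N x] by (auto simp: real_vs_def)
  qed (simp add: real_vs_def)
  show ?thesis
    by (rule submoduleI)
      (use assms inv in \<open>auto simp: Real_Vector_Spaces.subspace_neg\<close>,
       (use assms in \<open>auto simp: real_vs_def Real_Vector_Spaces.subspace_def\<close>))
qed

lemma module_quotient_module:
  fixes R :: "('a, 'c) ring_scheme" and M :: "('a, 'b) module"
  assumes "Module.module R M" "Module.submodule N R M"
  shows "Module.module R (quotient_module M N)"
    and "\<And>c x. c \<in> carrier R \<Longrightarrow> x \<in> carrier M \<Longrightarrow>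
           c \<odot>\<^bsub>quotient_module M N\<^esub> (N +>\<^bsub>M\<^esub> x) = N +>\<^bsub>M\<^esub> (c \<odot>\<^bsub>M\<^esub> x)"
proof -
  interpret Module.module R M by fact
  interpret N: Module.submodule N R M by fact
  interpret as: abelian_subgroup N M
    by (rule abelian_subgroupI3) (unfold_locales)
  show sm: "c \<odot>\<^bsub>quotient_module M N\<^esub> (N +>\<^bsub>M\<^esub> x) = N +>\<^bsub>M\<^esub> (c \<odot>\<^bsub>M\<^esub> x)"
    if c: "c \<in> carrier R" and x: "x \<in> carrier M" for c x
  proof -
    have "N +>\<^bsub>M\<^esub> (c \<odot>\<^bsub>M\<^esub> y) = N +>\<^bsub>M\<^esub> (c \<odot>\<^bsub>M\<^esub> x)" if y: "y \<in> N +>\<^bsub>M\<^esub> x" for y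
    proof -
      obtain h where h: "h \<in> N" "y = h \<oplus>\<^bsub>M\<^esub> x" using y by (auto simp: a_r_coset_def r_coset_def)
      have hM: "h \<in> carrier M" using h as.a_subset by auto
      have "c \<odot>\<^bsub>M\<^esub> y = c \<odot>\<^bsub>M\<^esub> h \<oplus>\<^bsub>M\<^esub> c \<odot>\<^bsub>M\<^esub> x"
        using h hM c x by (simp add: smult_r_distr)
      then have "c \<odot>\<^bsub>M\<^esub> y \<in> N +>\<^bsub>M\<^esub> (c \<odot>\<^bsub>M\<^esub> x)"
        using N.smult_closed[OF c h(1)] by (auto simp: a_r_coset_def r_coset_def)
      then show ?thesis
        using as.a_repr_independence'[of "c \<odot>\<^bsub>M\<^esub> y" "c \<odot>\<^bsub>M\<^esub> x"] c x
        by (simp only: smult_closed)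
    qed
    then have "(\<Union>y\<in>N +>\<^bsub>M\<^esub> x. N +>\<^bsub>M\<^esub> (c \<odot>\<^bsub>M\<^esub> y))
                 = (\<Union>y\<in>N +>\<^bsub>M\<^esub> x. N +>\<^bsub>M\<^esub> (c \<odot>\<^bsub>M\<^esub> x))"
      by (rule SUP_cong[OF refl])
    moreover have "x \<in> N +>\<^bsub>M\<^esub> x" using x by (rule as.a_rcos_self)
    then have "N +>\<^bsub>M\<^esub> x \<noteq> {}" by blast
    ultimately show ?thesis by (simp only: quotient_module_def module.simps UN_constant if_False)
  qed
  have carr: "carrier (quotient_module M N) = (\<lambda>x. N +>\<^bsub>M\<^esub> x) ` carrier M"
    by (auto simp: quotient_module_def a_r_coset_def A_RCOSETS_def RCOSETS_def)
  have add: "(N +>\<^bsub>M\<^esub> x) \<oplus>\<^bsub>quotient_module M N\<^esub> (N +>\<^bsub>M\<^esub> y) = N +>\<^bsub>M\<^esub> (x \<oplus>\<^bsub>M\<^esub> y)"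
    if "x \<in> carrier M" "y \<in> carrier M" for x y
    using that by (simp add: quotient_module_def as.a_rcos_sum)
  have zero: "\<zero>\<^bsub>quotient_module M N\<^esub> = N +>\<^bsub>M\<^esub> \<zero>\<^bsub>M\<^esub>"
    using as.a_subset by (simp add: quotient_module_def a_coset_add_zero)
  have ab: "abelian_group (quotient_module M N)"
  proof (rule abelian_groupI)
    fix X assume "X \<in> carrier (quotient_module M N)"
    then obtain x where x: "x \<in> carrier M" "X = N +>\<^bsub>M\<^esub> x" by (auto simp: carr)
    show "\<exists>Y\<in>carrier (quotient_module M N). Y \<oplus>\<^bsub>quotient_module M N\<^esub> X = \<zero>\<^bsub>quotient_module M N\<^esub>"
      using x by (intro bexI[of _ "N +>\<^bsub>M\<^esub> (\<ominus>\<^bsub>M\<^esub> x)"]) (auto simp: add zero carr M.l_neg)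
  qed (auto simp: carr add zero M.a_ac)
  show "Module.module R (quotient_module M N)"
    by (rule moduleI[OF R.is_cring ab])
      (auto simp: carr sm add smult_l_distr smult_r_distr smult_assoc1)
qed

lemma vectorspace_c0_quotient:
  assumes "ideal_on_nat I" "ideal_on_nat J" "I \<subseteq> J"
  shows "vectorspace class_ring (quotient_module (real_vs (c0_ideal J)) (c0_ideal I))"
proof -
  have "c0_ideal I \<subseteq> c0_ideal J"
    using assms(3) by (auto simp: c0_ideal_def)
  then have "Module.submodule (c0_ideal I) class_ring (real_vs (c0_ideal J))"
    by (intro submodule_real_vs subspace_c0_ideal assms)
  moreover have "vectorspace class_ring (real_vs (c0_ideal J))"
    by (intro vectorspace_real_vs subspace_c0_ideal assms)
  ultimately show ?thesis
    by (auto simp: vectorspace_def intro: module_quotient_module)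
qed

end

theory Submission
  imports Defs
begin

text \<open>
  Everything is governed by pairwise disjoint sets that lie in \<open>J\<close> but not in \<open>I\<close>. The indicators
  of such sets are linearly independent modulo \<open>c0_ideal I\<close>, because a linear combination takes the
  constant value \<open>c\<close> on the set that carries the coefficient \<open>c\<close>, and this set is not in \<open>I\<close>.

  If \<open>I\<close> is cut out of \<open>J\<close> by distinct maximal ideals \<open>L\<^sub>1, \<dots>, L\<^sub>k\<close> that do not contain \<open>J\<close>, then these
  ideals can be separated by pairwise disjoint sets \<open>A\<^sub>i \<in> J\<close> with \<open>A\<^sub>i \<notin> L\<^sub>i\<close>
  (\<open>separate_maximal_ideals\<close>). Each bounded sequence \<open>x\<close> has a limit \<open>c\<^sub>i\<close> along every \<open>L\<^sub>i\<close>
  (\<open>limit_along_maximal_ideal\<close>), and for \<open>x \<in> c0_ideal J\<close> the difference of \<open>x\<close> and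
  \<open>\<Sum>i. c\<^sub>i \<cdot> 1\<^bsub>A\<^sub>i\<^esub>\<close> lies in \<open>c0_ideal I\<close>. So the indicators of the \<open>A\<^sub>i\<close> are a basis of the quotient
  (\<open>has_dim_of_k_maximal\<close>).

  Conversely, if the quotient has dimension \<open>k\<close>, then independence bounds the length of a disjoint
  family in \<open>J - I\<close> by \<open>k\<close>. Let \<open>A\<^sub>1, \<dots>, A\<^sub>m\<close> be a longest one. Then no \<open>A\<^sub>i\<close> splits into two parts
  outside \<open>I\<close>, which says that \<open>L\<^sub>i = {B. B \<inter> A\<^sub>i \<in> I}\<close> is a maximal ideal, and a set of \<open>J\<close> that
  meets each \<open>A\<^sub>i\<close> in a set of \<open>I\<close> is itself in \<open>I\<close>. Hence \<open>I\<close> is \<open>m\<close>-maximal in \<open>J\<close>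
  (\<open>k_maximal_of_longest_family\<close>). The first half now computes the dimension as \<open>m\<close>, so \<open>m = k\<close>.
\<close>

section \<open>Bases of a quotient of real vector spaces\<close>

definition coset :: "'a::real_vector set \<Rightarrow> 'a \<Rightarrow> 'a set" where
  "coset N x = (\<lambda>h. h + x) ` N"

locale subspace_pair =
  fixes S N :: "'a::real_vector set"
  assumes S: "Real_Vector_Spaces.subspace S" and N: "Real_Vector_Spaces.subspace N"
    and N_le_S: "N \<subseteq> S"
begin

abbreviation Q :: "(real, 'a set) module" where
  "Q \<equiv> quotient_module (real_vs S) N"

lemma vectorspace_Q: "vectorspace class_ring Q"
  using module_quotient_module(1)[OF _ submodule_real_vs[OF S N N_le_S]] vectorspace_real_vs[OF S]
  by (auto simp: vectorspace_def)

sublocale Q: vectorspace class_ring Q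
  by (rule vectorspace_Q)

lemma coset_eq_a_r_coset: "coset N x = N +>\<^bsub>real_vs S\<^esub> x"
  by (auto simp: coset_def a_r_coset_def r_coset_def real_vs_def)

lemma coset_eq_iff: "coset N x = coset N y \<longleftrightarrow> x - y \<in> N"
proof
  assume "coset N x = coset N y"
  moreover have "x \<in> coset N x"
    using Real_Vector_Spaces.subspace_0[OF N] by (force simp: coset_def)
  ultimately show "x - y \<in> N"
    by (auto simp: coset_def)
next
  have le: "coset N x \<subseteq> coset N y" if "x - y \<in> N" for x y
  proof
    fix z assume "z \<in> coset N x"
    then obtain h where "h \<in> N" "z = h + x" by (auto simp: coset_def)
    then have "h + (x - y) \<in> N" "z = (h + (x - y)) + y"
      using that Real_Vector_Spaces.subspace_add[OF N] by auto
    then show "z \<in> coset N y" unfolding coset_def by blast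
  qed
  assume "x - y \<in> N"
  moreover from this have "y - x \<in> N"
    using Real_Vector_Spaces.subspace_neg[OF N] by fastforce
  ultimately show "coset N x = coset N y" using le by blast
qed

lemma coset_0: "coset N 0 = N"
  by (simp add: coset_def)

lemma carrier_Q: "carrier Q = coset N ` S"
  by (auto simp: quotient_module_def A_RCOSETS_def RCOSETS_def coset_def r_coset_def real_vs_def)

lemma zero_Q: "\<zero>\<^bsub>Q\<^esub> = coset N 0"
  by (simp add: quotient_module_def coset_0)

lemma add_Q: "coset N x \<oplus>\<^bsub>Q\<^esub> coset N y = coset N (x + y)" if "x \<in> S" "y \<in> S"
proof -
  interpret M: vectorspace class_ring "real_vs S" by (rule vectorspace_real_vs) (rule S)
  interpret N: Module.submodule N class_ring "real_vs S"
    by (rule submodule_real_vs[OF S N N_le_S])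
  interpret as: abelian_subgroup N "real_vs S"
    by (rule abelian_subgroupI3) unfold_locales
  show ?thesis
    using that as.a_rcos_sum[of x y] unfolding coset_eq_a_r_coset
    by (simp add: quotient_module_def) (simp add: real_vs_def)
qed

lemma smult_Q: "c \<odot>\<^bsub>Q\<^esub> coset N x = coset N (c *\<^sub>R x)" if "x \<in> S"
proof -
  have "Module.module class_ring (real_vs S)"
    using vectorspace_real_vs[OF S] by (simp add: vectorspace_def)
  from module_quotient_module(2)[OF this submodule_real_vs[OF S N N_le_S], of c x]
  show ?thesis using that by (simp add: coset_eq_a_r_coset real_vs_def)
qed

lemma finsum_cosets:
  assumes "finite T" "f ` T \<subseteq> S"
  shows "(\<Oplus>\<^bsub>Q\<^esub>i\<in>T. c i \<odot>\<^bsub>Q\<^esub> coset N (f i)) = coset N (\<Sum>i\<in>T. c i *\<^sub>R f i)"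
  using assms
proof (induction T)
  case empty
  then show ?case by (simp add: zero_Q)
next
  case (insert i T)
  have mem: "c j *\<^sub>R f j \<in> S" if "j \<in> insert i T" for j
    using that insert.prems Real_Vector_Spaces.subspace_scale[OF S] by auto
  then have "(\<Sum>j\<in>T. c j *\<^sub>R f j) \<in> S"
    by (intro Real_Vector_Spaces.subspace_sum[OF S]) auto
  moreover have "c j \<odot>\<^bsub>Q\<^esub> coset N (f j) = coset N (c j *\<^sub>R f j)" if "j \<in> insert i T" for j
    using that insert.prems by (intro smult_Q) auto
  moreover have "coset N (c j *\<^sub>R f j) \<in> carrier Q" if "j \<in> insert i T" for j
    using mem[OF that] by (simp add: carrier_Q)
  ultimately show ?case
    using insert mem by (simp add: Q.finsum_insert add_Q)
qed

lemma cosets_independent: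
  assumes T: "finite T" "f ` T \<subseteq> S"
    and indep: "\<And>c. (\<Sum>i\<in>T. c i *\<^sub>R f i) \<in> N \<Longrightarrow> \<forall>i\<in>T. c i = 0"
  shows "inj_on (\<lambda>i. coset N (f i)) T" "Q.lin_indpt ((\<lambda>i. coset N (f i)) ` T)"
proof -
  show inj: "inj_on (\<lambda>i. coset N (f i)) T"
  proof (rule inj_onI, rule ccontr)
    fix i j assume ij: "i \<in> T" "j \<in> T" "coset N (f i) = coset N (f j)" "i \<noteq> j"
    \<comment> \<open>coinciding cosets would put \<open>f i - f j\<close> into \<open>N\<close>, which is a nontrivial relation\<close>
    define c where "c l = (if l = i then 1 else if l = j then -1 else 0 :: real)" for l
    have "(\<Sum>l\<in>T. c l *\<^sub>R f l) = (\<Sum>l\<in>{i,j}. c l *\<^sub>R f l)"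
      by (rule sum.mono_neutral_right) (use T ij in \<open>auto simp: c_def\<close>)
    also have "\<dots> = f i - f j" using ij by (simp add: c_def)
    also have "\<dots> \<in> N" using ij(3) by (simp add: coset_eq_iff)
    finally have "c i = 0" using indep ij by blast
    then show False by (simp add: c_def)
  qed
  have carr: "(\<lambda>i. coset N (f i)) ` T \<subseteq> carrier Q" using T by (auto simp: carrier_Q)
  show "Q.lin_indpt ((\<lambda>i. coset N (f i)) ` T)"
  proof (rule Q.finite_lin_indpt2)
    fix a assume "Q.lincomb a ((\<lambda>i. coset N (f i)) ` T) = \<zero>\<^bsub>Q\<^esub>"
    also have "Q.lincomb a ((\<lambda>i. coset N (f i)) ` T)
        = (\<Oplus>\<^bsub>Q\<^esub>i\<in>T. a (coset N (f i)) \<odot>\<^bsub>Q\<^esub> coset N (f i))"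
      unfolding Q.lincomb_def
      by (rule Q.finsum_reindex[OF _ inj]) (use carr in auto)
    finally have "coset N (\<Sum>i\<in>T. a (coset N (f i)) *\<^sub>R f i) = coset N 0"
      using finsum_cosets[OF T] by (simp add: zero_Q)
    then have "(\<Sum>i\<in>T. a (coset N (f i)) *\<^sub>R f i) \<in> N" by (simp add: coset_eq_iff)
    from indep[OF this]
    show "\<forall>v\<in>(\<lambda>i. coset N (f i)) ` T. a v = \<zero>\<^bsub>class_ring\<^esub>" by simp
  qed (use T carr in auto)
qed

lemma card_le_of_independent:
  assumes "has_dim Q k"
    and T: "finite T" "f ` T \<subseteq> S"
    and indep: "\<And>c. (\<Sum>i\<in>T. c i *\<^sub>R f i) \<in> N \<Longrightarrow> \<forall>i\<in>T. c i = 0"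
  shows "card T \<le> k"
proof -
  have "card ((\<lambda>i. coset N (f i)) ` T) \<le> k"
    using Q.li_le_dim(2)[OF _ _ cosets_independent(2)[OF T indep]] assms(1) T
    by (auto simp: has_dim_def carrier_Q)
  then show ?thesis
    using card_image[OF cosets_independent(1)[OF T indep]] by simp
qed

lemma has_dim_of_basis:
  assumes T: "finite T" "f ` T \<subseteq> S"
    and indep: "\<And>c. (\<Sum>i\<in>T. c i *\<^sub>R f i) \<in> N \<Longrightarrow> \<forall>i\<in>T. c i = 0"
    and span: "\<And>x. x \<in> S \<Longrightarrow> \<exists>c. x - (\<Sum>i\<in>T. c i *\<^sub>R f i) \<in> N"
  shows "has_dim Q (card T)"
proof -
  let ?B = "(\<lambda>i. coset N (f i)) ` T"
  note inj = cosets_independent(1)[OF T indep]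
  have carr: "?B \<subseteq> carrier Q" using T by (auto simp: carrier_Q)
  have gen: "Q.gen_set ?B"
  proof
    show "Q.span ?B \<subseteq> carrier Q" using carr by (rule Q.span_is_subset2)
    show "carrier Q \<subseteq> Q.span ?B"
    proof
      fix X assume "X \<in> carrier Q"
      then obtain x where x: "x \<in> S" "X = coset N x" by (auto simp: carrier_Q)
      obtain c where c: "x - (\<Sum>i\<in>T. c i *\<^sub>R f i) \<in> N" using span[OF x(1)] by blast
      define a where "a v = c (inv_into T (\<lambda>i. coset N (f i)) v)" for v
      have a: "a (coset N (f i)) = c i" if "i \<in> T" for i
        using inv_into_f_f[OF inj that] by (simp add: a_def)
      have "Q.lincomb a ?B = (\<Oplus>\<^bsub>Q\<^esub>i\<in>T. a (coset N (f i)) \<odot>\<^bsub>Q\<^esub> coset N (f i))"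
        unfolding Q.lincomb_def by (rule Q.finsum_reindex[OF _ inj]) (use carr in auto)
      also have "\<dots> = coset N (\<Sum>i\<in>T. c i *\<^sub>R f i)"
        using finsum_cosets[OF T, of "\<lambda>i. a (coset N (f i))"] by (simp add: a)
      also have "\<dots> = X" using c by (simp add: x coset_eq_iff[symmetric])
      finally show "X \<in> Q.span ?B"
        unfolding Q.span_def using T(1) by (auto intro!: exI[of _ a] exI[of _ ?B])
    qed
  qed
  have "Q.basis ?B"
    using gen carr cosets_independent(2)[OF T indep] by (simp add: Q.basis_def)
  then have "Q.dim = card ?B" using T by (intro Q.dim_basis) auto
  moreover have "Q.fin_dim" using gen carr T unfolding Q.fin_dim_def by blast
  ultimately show ?thesis using card_image[OF inj] by (simp add: has_dim_def)
qed

end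

section \<open>Maximal ideals\<close>

lemma ideal_empty: "ideal_on_nat I \<Longrightarrow> {} \<in> I"
  and ideal_subset: "ideal_on_nat I \<Longrightarrow> A \<in> I \<Longrightarrow> B \<subseteq> A \<Longrightarrow> B \<in> I"
  and ideal_Un: "ideal_on_nat I \<Longrightarrow> A \<in> I \<Longrightarrow> B \<in> I \<Longrightarrow> A \<union> B \<in> I"
  by (auto simp: ideal_on_nat_def)

lemma ideal_UN:
  assumes "ideal_on_nat I" "finite T" "\<And>i. i \<in> T \<Longrightarrow> A i \<in> I"
  shows "(\<Union>i\<in>T. A i) \<in> I"
  using assms(2,3) by (induction T) (auto simp: ideal_empty ideal_Un assms(1))

lemma maximal_ideal_ideal: "maximal_ideal_on_nat L \<Longrightarrow> ideal_on_nat L"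
  by (simp add: maximal_ideal_on_nat_def)

lemma maximal_ideal_UNIV_notin: "UNIV \<notin> L" if "maximal_ideal_on_nat L"
  using that ideal_subset[of L UNIV] by (auto simp: maximal_ideal_on_nat_def)

text \<open>The ideal generated by \<open>L\<close> and a set \<open>A\<close> outside \<open>L\<close> is improper, so a member of \<open>L\<close> covers
  the complement of \<open>A\<close>.\<close>

lemma maximal_ideal_Compl:
  assumes L: "maximal_ideal_on_nat L" and A: "A \<notin> L"
  shows "- A \<in> L"
proof -
  note I = maximal_ideal_ideal[OF L]
  define K where "K = {X. \<exists>B\<in>L. X \<subseteq> A \<union> B}"
  have K: "X \<in> K" if "B \<in> L" "X \<subseteq> A \<union> B" for X B using that by (auto simp: K_def)
  have "ideal_on_nat K"
    unfolding ideal_on_nat_def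
  proof (intro conjI ballI allI impI)
    show "{} \<in> K" by (rule K[OF ideal_empty[OF I]]) simp
  next
    fix X Y assume "X \<in> K" "Y \<subseteq> X"
    then show "Y \<in> K" by (auto simp: K_def)
  next
    fix X Y assume "X \<in> K" "Y \<in> K"
    then obtain B C where "B \<in> L" "X \<subseteq> A \<union> B" "C \<in> L" "Y \<subseteq> A \<union> C" by (auto simp: K_def)
    then show "X \<union> Y \<in> K" by (intro K[of "B \<union> C"] ideal_Un[OF I]) auto
  next
    fix X :: "nat set" assume "finite X"
    then have "X \<in> L" using I by (simp add: ideal_on_nat_def)
    then show "X \<in> K" by (rule K) simp
  qed
  moreover have "L \<subseteq> K" using K by blast
  moreover have "A \<in> K" by (rule K[OF ideal_empty[OF I]]) simp
  ultimately have "K = UNIV" using L A by (auto simp: maximal_ideal_on_nat_def)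
  then obtain B where "B \<in> L" "UNIV \<subseteq> A \<union> B" unfolding K_def by blast
  then show ?thesis by (auto intro: ideal_subset[OF I])
qed

lemma maximal_idealI:
  assumes L: "ideal_on_nat L" and "UNIV \<notin> L" and Compl: "\<And>A. A \<notin> L \<Longrightarrow> - A \<in> L"
  shows "maximal_ideal_on_nat L"
  unfolding maximal_ideal_on_nat_def
proof (intro conjI allI impI)
  show "L \<noteq> UNIV" using assms(2) by blast
  fix K assume K: "ideal_on_nat K \<and> L \<subset> K"
  then obtain A where "A \<in> K" "A \<notin> L" by blast
  then have "A \<union> - A \<in> K" using K Compl by (intro ideal_Un) auto
  then show "K = UNIV" using K by (auto intro: ideal_subset)
qed (rule L)

lemma maximal_ideal_Int_notin:
  assumes L: "maximal_ideal_on_nat L" and "A \<notin> L" "B \<notin> L"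
  shows "A \<inter> B \<notin> L"
proof
  note I = maximal_ideal_ideal[OF L]
  assume "A \<inter> B \<in> L"
  then have "(A \<inter> B) \<union> (- A \<union> - B) \<in> L"
    using assms by (intro ideal_Un[OF I] maximal_ideal_Compl)
  moreover have "(A \<inter> B) \<union> (- A \<union> - B) = UNIV" by blast
  ultimately show False using maximal_ideal_UNIV_notin[OF L] by simp
qed

lemma maximal_ideal_INT_notin:
  assumes L: "maximal_ideal_on_nat L" and "finite T" "\<And>i. i \<in> T \<Longrightarrow> A i \<notin> L"
  shows "(\<Inter>i\<in>T. A i) \<notin> L"
  using assms(2,3)
  by (induction T) (auto simp: maximal_ideal_Int_notin[OF L] maximal_ideal_UNIV_notin[OF L])

lemma maximal_ideals_eqI:
  assumes "maximal_ideal_on_nat L" "maximal_ideal_on_nat L'" "L \<subseteq> L'"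
  shows "L = L'"
  using assms unfolding maximal_ideal_on_nat_def by blast

text \<open>Intersecting a member of \<open>J\<close> outside \<open>L i\<close> with a witness of \<open>\<not> L j \<subseteq> L i\<close> for each other \<open>j\<close>
  gives a set \<open>E i\<close> that belongs to all other \<open>L j\<close> but, since \<open>L i\<close> is prime, not to \<open>L i\<close>.
  Subtracting the other \<open>E j\<close> from \<open>E i\<close> makes the sets disjoint, and what is subtracted belongs
  to \<open>L i\<close>.\<close>

lemma separate_maximal_ideals:
  assumes T: "finite T" and inj: "inj_on L T"
    and L: "\<And>i. i \<in> T \<Longrightarrow> maximal_ideal_on_nat (L i)"
    and J: "ideal_on_nat J" "\<And>i. i \<in> T \<Longrightarrow> \<not> J \<subseteq> L i"
  obtains A where "disjoint_family_on A T" "\<And>i. i \<in> T \<Longrightarrow> A i \<in> J" "\<And>i. i \<in> T \<Longrightarrow> A i \<notin> L i"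
proof -
  have "\<forall>i\<in>T. \<exists>C. C \<in> J \<and> C \<notin> L i" using J by blast
  then obtain C where C: "\<And>i. i \<in> T \<Longrightarrow> C i \<in> J \<and> C i \<notin> L i" by metis
  have "\<exists>D. D \<in> L j \<and> D \<notin> L i" if "i \<in> T" "j \<in> T" "i \<noteq> j" for i j
    using maximal_ideals_eqI[OF L L, of j i] inj_onD[OF inj, of j i] that by blast
  then obtain D where D: "\<And>i j. i \<in> T \<Longrightarrow> j \<in> T \<Longrightarrow> i \<noteq> j \<Longrightarrow> D i j \<in> L j \<and> D i j \<notin> L i" by metis
  define E where "E i = C i \<inter> (\<Inter>j\<in>T - {i}. D i j)" for i
  have E_notin: "E i \<notin> L i" if "i \<in> T" for i
    unfolding E_def using that T C D
    by (intro maximal_ideal_Int_notin maximal_ideal_INT_notin L) auto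
  have E_in: "E i \<in> L j" if "i \<in> T" "j \<in> T" "i \<noteq> j" for i j
    by (rule ideal_subset[OF maximal_ideal_ideal[OF L[OF that(2)]], of "D i j"])
      (use D[OF that] that in \<open>auto simp: E_def\<close>)
  define A where "A i = E i - (\<Union>j\<in>T - {i}. E j)" for i
  show ?thesis
  proof
    show "disjoint_family_on A T" unfolding disjoint_family_on_def A_def by blast
  next
    fix i assume "i \<in> T"
    then show "A i \<in> J"
      using C[of i] by (auto intro: ideal_subset[OF J(1), of "C i"] simp: A_def E_def)
  next
    fix i assume i: "i \<in> T"
    note Li = maximal_ideal_ideal[OF L[OF i]]
    show "A i \<notin> L i"
    proof
      assume "A i \<in> L i"
      moreover have "(\<Union>j\<in>T - {i}. E j) \<in> L i" using E_in i T by (intro ideal_UN[OF Li]) auto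
      ultimately have "A i \<union> (\<Union>j\<in>T - {i}. E j) \<in> L i" by (rule ideal_Un[OF Li])
      then have "E i \<in> L i" by (rule ideal_subset[OF Li]) (auto simp: A_def)
      then show False using E_notin[OF i] by blast
    qed
  qed
qed

text \<open>The complements of the members of \<open>L\<close> form an ultrafilter, and the limit is the supremum of
  the numbers \<open>t\<close> such that \<open>x\<close> is at least \<open>t\<close> off a member of \<open>L\<close>.\<close>

lemma limit_along_maximal_ideal:
  fixes x :: "nat \<Rightarrow> real"
  assumes L: "maximal_ideal_on_nat L" and x: "bounded (range x)"
  obtains c where "\<And>e. e > 0 \<Longrightarrow> {n. \<bar>x n - c\<bar> \<ge> e} \<in> L"
proof -
  note I = maximal_ideal_ideal[OF L]
  obtain M where M: "\<bar>x n\<bar> \<le> M" for n using x by (auto simp: bounded_iff)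
  define T where "T = {t. {n. x n < t} \<in> L}"
  have "\<not> x n < - M" for n using M[of n] by linarith
  then have "- M \<in> T" using ideal_empty[OF I] by (simp add: T_def)
  then have ne: "T \<noteq> {}" by blast
  have "t \<le> M" if t: "t \<in> T" for t
  proof (rule ccontr)
    assume "\<not> t \<le> M"
    then have "x n < t" for n using M[of n] by linarith
    then have "{n. x n < t} = UNIV" by simp
    then show False using t maximal_ideal_UNIV_notin[OF L] by (simp add: T_def)
  qed
  then have bdd: "bdd_above T" by (auto simp: bdd_above_def)
  show ?thesis
  proof
    fix e :: real assume e: "e > 0"
    obtain t where t: "t \<in> T" "Sup T - e < t"
      using less_cSup_iff[OF ne bdd, of "Sup T - e"] e by auto
    have "Sup T + e / 2 \<notin> T" using cSup_upper[OF _ bdd, of "Sup T + e / 2"] e by auto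
    then have "- {n. x n < Sup T + e / 2} \<in> L" by (auto simp: T_def intro: maximal_ideal_Compl[OF L])
    then have "{n. x n < t} \<union> - {n. x n < Sup T + e / 2} \<in> L"
      using t by (auto simp: T_def intro: ideal_Un[OF I])
    then show "{n. \<bar>x n - Sup T\<bar> \<ge> e} \<in> L"
      by (rule ideal_subset[OF I]) (use e t in \<open>auto simp: abs_if split: if_splits\<close>)
  qed
qed

section \<open>Indicators of disjoint sets\<close>

definition ind :: "nat set \<Rightarrow> nat \<Rightarrow>\<^sub>C real" where
  "ind A = Bcontfun (indicator A)"

lemma apply_ind: "apply_bcontfun (ind A) = indicator A"
proof -
  have "bounded (range (indicator A :: nat \<Rightarrow> real))"
    by (rule boundedI[of _ 1]) (auto simp: indicator_def)
  then have "(indicator A :: nat \<Rightarrow> real) \<in> bcontfun"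
    by (simp add: bcontfun_def)
  then show ?thesis by (simp add: ind_def Bcontfun_inverse)
qed

lemma apply_bcontfun_sum:
  "apply_bcontfun (\<Sum>i\<in>T. f i) n = (\<Sum>i\<in>T. apply_bcontfun (f i) n)"
  by (induction T rule: infinite_finite_induct) (auto simp: plus_bcontfun.rep_eq)

lemma sum_ind_eq_coefficient:
  assumes "finite T" "disjoint_family_on A T" "i \<in> T" "n \<in> A i"
  shows "apply_bcontfun (\<Sum>j\<in>T. c j *\<^sub>R ind (A j)) n = c i"
proof -
  have "apply_bcontfun (\<Sum>j\<in>T. c j *\<^sub>R ind (A j)) n = (\<Sum>j\<in>T. if j = i then c i else 0)"
    unfolding apply_bcontfun_sum
    by (rule sum.cong)
      (use assms in \<open>auto simp: apply_ind indicator_def disjoint_family_on_def\<close>)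
  then show ?thesis using assms by simp
qed

lemma ind_in_c0_ideal:
  assumes "ideal_on_nat J" "A \<in> J"
  shows "ind A \<in> c0_ideal J"
  unfolding c0_ideal_def
proof (intro CollectI allI impI)
  fix e :: real assume "e > 0"
  then show "{n. \<bar>apply_bcontfun (ind A) n\<bar> \<ge> e} \<in> J"
    by (intro ideal_subset[OF assms]) (auto simp: apply_ind indicator_def split: if_splits)
qed

text \<open>If \<open>c i \<noteq> 0\<close>, then the combination has absolute value \<open>\<bar>c i\<bar>\<close> on all of \<open>A i\<close>, so \<open>A i\<close> would
  be a member of \<open>I\<close>.\<close>

lemma indicators_independent:
  assumes I: "ideal_on_nat I" and T: "finite T" "disjoint_family_on A T"
    and A: "\<And>i. i \<in> T \<Longrightarrow> A i \<notin> I"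
    and c: "(\<Sum>i\<in>T. c i *\<^sub>R ind (A i)) \<in> c0_ideal I"
  shows "\<forall>i\<in>T. c i = 0"
proof (intro ballI, rule ccontr)
  fix i assume i: "i \<in> T" "c i \<noteq> 0"
  then have "{n. \<bar>apply_bcontfun (\<Sum>i\<in>T. c i *\<^sub>R ind (A i)) n\<bar> \<ge> \<bar>c i\<bar>} \<in> I"
    using c by (auto simp: c0_ideal_def)
  then have "A i \<in> I"
    by (rule ideal_subset[OF I]) (use sum_ind_eq_coefficient[OF T i(1)] in auto)
  then show False using A i by blast
qed

lemma subspace_pair_c0_ideal:
  assumes "ideal_on_nat I" "ideal_on_nat J" "I \<subseteq> J"
  shows "subspace_pair (c0_ideal J) (c0_ideal I)"
proof
  show "c0_ideal I \<subseteq> c0_ideal J" using assms(3) by (auto simp: c0_ideal_def)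
qed (rule subspace_c0_ideal assms)+

lemma card_le_dim_of_disjoint_family:
  assumes I: "ideal_on_nat I" and J: "ideal_on_nat J" and "I \<subseteq> J"
    and dim: "has_dim (quotient_module (real_vs (c0_ideal J)) (c0_ideal I)) k"
    and T: "finite T" "disjoint_family_on A T" "\<And>i. i \<in> T \<Longrightarrow> A i \<in> J - I"
  shows "card T \<le> k"
proof -
  interpret subspace_pair "c0_ideal J" "c0_ideal I"
    using assms by (intro subspace_pair_c0_ideal)
  show ?thesis
  proof (rule card_le_of_independent[OF dim T(1)])
    show "(\<lambda>i. ind (A i)) ` T \<subseteq> c0_ideal J" using T J by (auto intro: ind_in_c0_ideal)
    show "\<forall>i\<in>T. c i = 0" if "(\<Sum>i\<in>T. c i *\<^sub>R ind (A i)) \<in> c0_ideal I" for c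
      using that T by (intro indicators_independent[OF I T(1,2)]) auto
  qed
qed

section \<open>The two implications\<close>

text \<open>On \<open>A i\<close> the combination of indicators below equals the limit of \<open>x\<close> along \<open>L i\<close>, and the
  complement of \<open>A i\<close> belongs to \<open>L i\<close>; so the difference of the two sequences tends to \<open>0\<close> along
  each \<open>L i\<close>.\<close>

lemma has_dim_of_k_maximal:
  assumes I: "ideal_on_nat I" and J: "ideal_on_nat J" and "I \<subseteq> J" and "k_maximal_in k I J"
  shows "has_dim (quotient_module (real_vs (c0_ideal J)) (c0_ideal I)) k"
proof -
  interpret subspace_pair "c0_ideal J" "c0_ideal I"
    using assms by (intro subspace_pair_c0_ideal)
  obtain L where L: "inj_on L {1..k}" "\<And>i. i \<in> {1..k} \<Longrightarrow> maximal_ideal_on_nat (L i)"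
      "\<And>i. i \<in> {1..k} \<Longrightarrow> \<not> J \<subseteq> L i"
    and I_eq: "I = (\<Inter>i\<in>{1..k}. L i) \<inter> J"
    using assms(4) unfolding k_maximal_in_def by blast
  obtain A where A: "disjoint_family_on A {1..k}" "\<And>i. i \<in> {1..k} \<Longrightarrow> A i \<in> J"
      "\<And>i. i \<in> {1..k} \<Longrightarrow> A i \<notin> L i"
    using separate_maximal_ideals[OF finite_atLeastAtMost L(1,2) J L(3)] by blast
  have A_notin: "A i \<notin> I" if "i \<in> {1..k}" for i
    using A(3)[OF that] that unfolding I_eq by blast
  have "has_dim Q (card {1..k})"
  proof (rule has_dim_of_basis)
    show "(\<lambda>i. ind (A i)) ` {1..k} \<subseteq> c0_ideal J" using A J by (auto intro: ind_in_c0_ideal)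
  next
    fix c assume "(\<Sum>i\<in>{1..k}. c i *\<^sub>R ind (A i)) \<in> c0_ideal I"
    then show "\<forall>i\<in>{1..k}. c i = 0"
      by (intro indicators_independent[OF I finite_atLeastAtMost A(1) A_notin])
  next
    fix x assume x: "x \<in> c0_ideal J"
    have "\<exists>c. \<forall>e>0. {n. \<bar>apply_bcontfun x n - c\<bar> \<ge> e} \<in> L i" if "i \<in> {1..k}" for i
      using limit_along_maximal_ideal[OF L(2)[OF that], of "apply_bcontfun x"] by auto
    then obtain c where c: "\<And>i e. i \<in> {1..k} \<Longrightarrow> e > 0 \<Longrightarrow> {n. \<bar>apply_bcontfun x n - c i\<bar> \<ge> e} \<in> L i"
      by metis
    define y where "y = x - (\<Sum>i\<in>{1..k}. c i *\<^sub>R ind (A i))"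
    have "y \<in> c0_ideal J"
      unfolding y_def using x A J
      by (intro Real_Vector_Spaces.subspace_diff[OF S] Real_Vector_Spaces.subspace_sum[OF S]
          Real_Vector_Spaces.subspace_scale[OF S] ind_in_c0_ideal)
    moreover have "{n. \<bar>apply_bcontfun y n\<bar> \<ge> e} \<in> L i" if i: "i \<in> {1..k}" and e: "e > 0" for i e
    proof (rule ideal_subset[OF maximal_ideal_ideal[OF L(2)[OF i]]])
      show "{n. \<bar>apply_bcontfun x n - c i\<bar> \<ge> e} \<union> - A i \<in> L i"
        using c[OF i e] A(3)[OF i] L(2)[OF i]
        by (intro ideal_Un maximal_ideal_ideal maximal_ideal_Compl)
      show "{n. \<bar>apply_bcontfun y n\<bar> \<ge> e} \<subseteq> {n. \<bar>apply_bcontfun x n - c i\<bar> \<ge> e} \<union> - A i"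
        using sum_ind_eq_coefficient[OF _ A(1) i, of _ c]
        by (auto simp: y_def minus_bcontfun.rep_eq)
    qed
    ultimately have "y \<in> c0_ideal I" by (auto simp: c0_ideal_def I_eq)
    then show "\<exists>c. x - (\<Sum>i\<in>{1..k}. c i *\<^sub>R ind (A i)) \<in> c0_ideal I" unfolding y_def by blast
  qed simp
  then show ?thesis by simp
qed

definition disjoint_outside :: "nat set set \<Rightarrow> nat set set \<Rightarrow> nat \<Rightarrow> (nat \<Rightarrow> nat set) \<Rightarrow> bool" where
  "disjoint_outside I J m A \<longleftrightarrow> disjoint_family_on A {1..m} \<and> (\<forall>i\<in>{1..m}. A i \<in> J - I)"

text \<open>Otherwise the part of \<open>B\<close> outside all \<open>A i\<close> would prolong the family.\<close>

lemma longest_family_absorbs: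
  assumes I: "ideal_on_nat I" and J: "ideal_on_nat J"
    and A: "disjoint_outside I J m A" and longest: "\<And>A'. \<not> disjoint_outside I J (Suc m) A'"
    and B: "B \<in> J" "\<And>i. i \<in> {1..m} \<Longrightarrow> B \<inter> A i \<in> I"
  shows "B \<in> I"
proof -
  define C where "C = B - (\<Union>i\<in>{1..m}. A i)"
  have "C \<in> I"
  proof (rule ccontr)
    assume "C \<notin> I"
    moreover have "C \<in> J" by (rule ideal_subset[OF J B(1)]) (auto simp: C_def)
    moreover have "C \<inter> A i = {}" "A i \<inter> C = {}" if "i \<in> {1..m}" for i using that by (auto simp: C_def)
    ultimately have "disjoint_outside I J (Suc m) (A(Suc m := C))"
      using A unfolding disjoint_outside_def disjoint_family_on_def atLeastAtMostSuc_conv[of 1 m, simplified]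
      by auto
    then show False using longest by blast
  qed
  then have "C \<union> (\<Union>i\<in>{1..m}. B \<inter> A i) \<in> I"
    using B by (intro ideal_Un[OF I] ideal_UN[OF I]) auto
  then show ?thesis by (rule ideal_subset[OF I]) (auto simp: C_def)
qed

text \<open>If \<open>A i \<inter> B\<close> is not in \<open>I\<close>, then replacing \<open>A i\<close> by \<open>A i \<inter> B\<close> gives another longest family. It
  is disjoint from \<open>A i - B\<close>, which must therefore be in \<open>I\<close>.\<close>

lemma longest_family_unsplittable:
  assumes I: "ideal_on_nat I" and J: "ideal_on_nat J"
    and A: "disjoint_outside I J m A" and longest: "\<And>A'. \<not> disjoint_outside I J (Suc m) A'"
    and i: "i \<in> {1..m}" and B: "A i \<inter> B \<notin> I"
  shows "A i - B \<in> I"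
proof -
  have AJ: "A i \<in> J" using A i by (simp add: disjoint_outside_def)
  have disj: "A j \<inter> A l = {}" if "j \<in> {1..m}" "l \<in> {1..m}" "j \<noteq> l" for j l
    using A that unfolding disjoint_outside_def disjoint_family_on_def by blast
  define A' where "A' = A(i := A i \<inter> B)"
  have A'_le: "A' j \<subseteq> A j" for j by (simp add: A'_def)
  have "disjoint_family_on A' {1..m}"
    unfolding disjoint_family_on_def using disj A'_le by blast
  moreover have "A' j \<in> J - I" if "j \<in> {1..m}" for j
  proof (cases "j = i")
    case True
    then show ?thesis using ideal_subset[OF J AJ, of "A i \<inter> B"] B by (simp add: A'_def)
  next
    case False
    then show ?thesis using A that by (simp add: A'_def disjoint_outside_def)
  qed
  ultimately have A': "disjoint_outside I J m A'" by (simp add: disjoint_outside_def)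
  show ?thesis
  proof (rule longest_family_absorbs[OF I J A' longest])
    show "A i - B \<in> J" by (rule ideal_subset[OF J AJ]) blast
    fix j assume j: "j \<in> {1..m}"
    have "(A i - B) \<inter> A' j = {}"
    proof (cases "j = i")
      case True
      then show ?thesis by (auto simp: A'_def)
    next
      case False
      then show ?thesis using disj[OF i j] A'_le[of j] by blast
    qed
    then show "(A i - B) \<inter> A' j \<in> I" using ideal_empty[OF I] by simp
  qed
qed

lemma k_maximal_of_longest_family:
  assumes I: "ideal_on_nat I" and J: "ideal_on_nat J" and "I \<subseteq> J"
    and A: "disjoint_outside I J m A" and longest: "\<And>A'. \<not> disjoint_outside I J (Suc m) A'"
  shows "k_maximal_in m I J"
proof -
  define L where "L i = {B. A i \<inter> B \<in> I}" for i
  have AJ: "A i \<in> J" and AI: "A i \<notin> I" if "i \<in> {1..m}" for i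
    using A that by (auto simp: disjoint_outside_def)
  have idl: "ideal_on_nat (L i)" for i
    unfolding ideal_on_nat_def
  proof (intro conjI ballI allI impI)
    fix B C assume "B \<in> L i" "C \<in> L i"
    then show "B \<union> C \<in> L i" using ideal_Un[OF I] by (simp add: L_def Int_Un_distrib)
  next
    fix B C assume "B \<in> L i" "C \<subseteq> B"
    then show "C \<in> L i" by (auto simp: L_def intro: ideal_subset[OF I, of "A i \<inter> B"])
  next
    fix B :: "nat set" assume "finite B"
    then show "B \<in> L i" using I by (simp add: L_def ideal_on_nat_def)
  qed (simp add: L_def ideal_empty[OF I])
  have "maximal_ideal_on_nat (L i)" if i: "i \<in> {1..m}" for i
  proof (rule maximal_idealI[OF idl])
    show "UNIV \<notin> L i" using AI[OF i] by (simp add: L_def)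
    show "- B \<in> L i" if "B \<notin> L i" for B
      using longest_family_unsplittable[OF I J A longest i, of B] that
      by (simp add: L_def Diff_eq)
  qed
  moreover have A_notin: "A i \<notin> L i" if "i \<in> {1..m}" for i
    using AI[OF that] by (simp add: L_def)
  moreover have "inj_on L {1..m}"
  proof (rule inj_onI, rule ccontr)
    fix i j assume ij: "i \<in> {1..m}" "j \<in> {1..m}" "L i = L j" "i \<noteq> j"
    then have "A j \<inter> A i = {}" using A by (auto simp: disjoint_outside_def disjoint_family_on_def)
    then have "A i \<in> L j" by (simp add: L_def ideal_empty[OF I])
    then show False using A_notin[OF ij(1)] ij(3) by simp
  qed
  moreover have "I = (\<Inter>i\<in>{1..m}. L i) \<inter> J"
  proof
    show "I \<subseteq> (\<Inter>i\<in>{1..m}. L i) \<inter> J"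
      using assms(3) by (auto simp: L_def intro: ideal_subset[OF I])
    show "(\<Inter>i\<in>{1..m}. L i) \<inter> J \<subseteq> I"
    proof
      fix B assume B: "B \<in> (\<Inter>i\<in>{1..m}. L i) \<inter> J"
      then have "B \<inter> A i \<in> I" if "i \<in> {1..m}" for i
        using that by (auto simp: L_def Int_commute)
      then show "B \<in> I"
        using B longest_family_absorbs[OF I J A longest] by blast
    qed
  qed
  ultimately show ?thesis
    unfolding k_maximal_in_def using AJ
    by (intro exI[of _ L]) blast
qed

theorem theorem4p6:
  fixes I J :: "nat set set" and k :: nat
  assumes "ideal_on_nat I" and "ideal_on_nat J" and "I \<subset> J" and "k > 0"
  shows "has_dim (quotient_module (real_vs (c0_ideal J)) (c0_ideal I)) k \<longleftrightarrow> k_maximal_in k I J"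
proof
  have le: "I \<subseteq> J" using assms(3) by blast
  show "has_dim (quotient_module (real_vs (c0_ideal J)) (c0_ideal I)) k" if "k_maximal_in k I J"
    using has_dim_of_k_maximal[OF assms(1,2) le that] .
  assume dim: "has_dim (quotient_module (real_vs (c0_ideal J)) (c0_ideal I)) k"
  let ?P = "\<lambda>m. \<exists>A. disjoint_outside I J m A"
  have bound: "m \<le> k" if "?P m" for m
    using that card_le_dim_of_disjoint_family[OF assms(1,2) le dim, of "{1..m}"]
    by (auto simp: disjoint_outside_def)
  have "?P 0" by (simp add: disjoint_outside_def disjoint_family_on_def)
  then obtain m where m: "?P m" "\<And>n. ?P n \<Longrightarrow> n \<le> m"
    using GreatestI_nat[of ?P 0 k] Greatest_le_nat[of ?P _ k] bound by blast
  then obtain A where "disjoint_outside I J m A" by blast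
  moreover have "\<not> disjoint_outside I J (Suc m) A'" for A' using m(2)[of "Suc m"] by auto
  ultimately have max: "k_maximal_in m I J"
    by (rule k_maximal_of_longest_family[OF assms(1,2) le])
  then have "has_dim (quotient_module (real_vs (c0_ideal J)) (c0_ideal I)) m"
    by (rule has_dim_of_k_maximal[OF assms(1,2) le])
  then have "m = k" using dim by (simp add: has_dim_def)
  then show "k_maximal_in k I J" using max by simp
qed

end
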